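(* Let $X=\{-1,1\}^{\mathbb N}$ and let $A:X\to\mathbb R$ be a potential in the class $\mathcal F$. If $f:X\to\mathbb R$ is an increasing non-negative function, then $\mathscr L_A(f)$ is an increasing function.
   Context: Points are $x=(x_1,x_2,\dots)$ and $ix=(i,x_1,x_2,\dots)$ for $i=\pm1$. Partial order: $y\succeq x$ iff $y_j\ge x_j$ for all $j$; $f$ is increasing if $y\succeq x$ implies $f(y)\ge f(x)$. The Ruelle operator is $\mathscr L_A(f)(x)=e^{A(1x)}f(1x)+e^{A(-1x)}f(-1x)$. Class $\mathcal F$: $A\in\mathcal F$ if for all $y\succeq x$ both $e^{A(-1x)}+e^{A(1x)}\le e^{A(-1y)}+e^{A(1y)}$ and $e^{A(1y)}-e^{A(1x)}\ge0$. *)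

theory Defs
  imports Complex_Main "HOL-Library.FuncSet"
begin

text \<open>
  Coordinates are indexed from 0, so \<open>x k\<close> is $x_{k+1}$. Functions on the space
  \<open>X\<close> are represented by total functions on \<open>nat \<Rightarrow> int\<close> whose values outside \<open>X\<close> are
  irrelevant. The partial order on configurations is the pointwise order \<open>(\<le>)\<close> on functions,
  so ``\<open>f\<close> is increasing'' is \<open>mono_on X f\<close>.
\<close>

type_synonym config = "nat \<Rightarrow> int"

definition X :: "config set" where
  "X = UNIV \<rightarrow> {-1, 1}"

definition prepend :: "int \<Rightarrow> config \<Rightarrow> config" where
  "prepend i x = case_nat i x"

definition ruelle :: "(config \<Rightarrow> real) \<Rightarrow> (config \<Rightarrow> real) \<Rightarrow> config \<Rightarrow> real" where
  "ruelle A f x =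
     exp (A (prepend 1 x)) * f (prepend 1 x) + exp (A (prepend (-1) x)) * f (prepend (-1) x)"

definition class_F :: "(config \<Rightarrow> real) set" where
  "class_F = {A. \<forall>x\<in>X. \<forall>y\<in>X. x \<le> y \<longrightarrow>
     exp (A (prepend (-1) x)) + exp (A (prepend 1 x))
       \<le> exp (A (prepend (-1) y)) + exp (A (prepend 1 y)) \<and>
     exp (A (prepend 1 y)) - exp (A (prepend 1 x)) \<ge> 0}"

end

theory Submission
  imports Defs
begin

text \<open>Pass from \<open>x\<close> to \<open>y\<close> in two moves: first change the weights
  \<open>exp (A (prepend i x))\<close> with the values of \<open>f\<close> held fixed, then change
  those values. The class controls the sum of the two weights and the weight at 1, but not the
  weight at -1 alone, so the first move needs the Ruelle sum regrouped around these two quantities.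
  The second move needs only nonnegative weights and monotonicity of \<open>f\<close>.\<close>

lemma prepend_in_X: "i \<in> {-1, 1} \<Longrightarrow> x \<in> X \<Longrightarrow> prepend i x \<in> X"
  by (auto simp: X_def prepend_def Pi_iff split: nat.split)

lemma prepend_mono: "i \<le> j \<Longrightarrow> x \<le> y \<Longrightarrow> prepend i x \<le> prepend j y"
  by (auto simp: prepend_def le_fun_def split: nat.split)

theorem proposition5:
  fixes A f :: "config \<Rightarrow> real"
  assumes "A \<in> class_F"
    and "mono_on X f"
    and "\<And>x. x \<in> X \<Longrightarrow> f x \<ge> 0"
  shows "mono_on X (ruelle A f)"
proof (rule mono_onI)
  fix x y assume xy: "x \<in> X" "y \<in> X" "x \<le> y"
  define a b where "a z = exp (A (prepend 1 z))" and "b z = exp (A (prepend (-1) z))" for z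
  define p q where "p z = f (prepend 1 z)" and "q z = f (prepend (-1) z)" for z
  have ab: "a x + b x \<le> a y + b y" "a x \<le> a y"
    using assms(1) xy by (auto simp: class_F_def a_def b_def add.commute)
  have pos: "a y \<ge> 0" "b y \<ge> 0"
    by (simp_all add: a_def b_def)
  \<comment> \<open>The last inequality compares the two preimages of the same point, as
    \<open>prepend (-1) x \<le> prepend 1 x\<close>.\<close>
  have pq: "p x \<le> p y" "q x \<le> q y" "q x \<le> p x"
    unfolding p_def q_def using xy
    by (auto intro!: mono_onD[OF assms(2)] prepend_in_X prepend_mono)
  have q0: "q x \<ge> 0"
    unfolding q_def using xy by (intro assms(3) prepend_in_X) auto
  \<comment> \<open>Summation by parts: the coefficients \<open>q x\<close> and
    \<open>p x - q x\<close> are nonnegative, and they multiply exactly the two quantities that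
    increase by \<open>ab\<close>.\<close>
  have "ruelle A f x = (a x + b x) * q x + a x * (p x - q x)"
    by (simp add: ruelle_def a_def b_def p_def q_def algebra_simps)
  also have "\<dots> \<le> (a y + b y) * q x + a y * (p x - q x)"
    using ab pq q0 by (intro add_mono[OF mult_right_mono mult_right_mono]) auto
  also have "\<dots> = a y * p x + b y * q x"
    by (simp add: algebra_simps)
  also have "\<dots> \<le> a y * p y + b y * q y"
    using pq pos by (intro add_mono mult_left_mono)
  also have "\<dots> = ruelle A f y"
    by (simp add: ruelle_def a_def b_def p_def q_def)
  finally show "ruelle A f x \<le> ruelle A f y" .
qed

end
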